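(* Let $\mathcal{C}\subseteq\mathbb{M}$ be a code of dimension $k\geq 1$. Then $\mathcal{C}$ satisfies the chain condition if and only if $d_r(\mathcal{C})=g_r(\mathcal{C})$ for all $r\in[k]$.
   Context: Write $[r]=\{1,\ldots,r\}$. Let $q$ be a prime power and let $t,n_1,\ldots,n_t,m_1,\ldots,m_t$ be positive integers with $m_1\geq\cdots\geq m_t$ and $m_i\geq n_i$ for $i\in[t]$. Let $\mathbb{M}=\mathbb{F}_q^{m_1\times n_1}\times\cdots\times\mathbb{F}_q^{m_t\times n_t}$. For $C=(C_1,\ldots,C_t)\in\mathbb{M}$ let $\mathrm{srk}(C)=\sum_{i=1}^t\mathrm{rk}(C_i)$. A code is an $\mathbb{F}_q$-linear subspace $\mathcal{C}\subseteq\mathbb{M}$; a subcode is a linear subspace of a code; $\mathrm{maxsrk}(\mathcal{C})=\max\{\mathrm{srk}(C) : C\in\mathcal{C}\}$. A linear subspace $\mathcal{A}_i\subseteq\mathbb{F}_q^{m_i\times n_i}$ is an optimal anticode (OAC) if $\dim(\mathcal{A}_i)=m_i\max\{\mathrm{rk}(A) : A\in\mathcal{A}_i\}$. The weight of a code is $\mathrm{wt}(\mathcal{C})=\min\{\mathrm{maxsrk}(\mathcal{A}) : \mathcal{C}\subseteq\mathcal{A}=\mathcal{A}_1\times\cdots\times\mathcal{A}_t,\ \mathcal{A}_i\subseteq\mathbb{F}_q^{m_i\times n_i}\text{ an OAC for all }i\in[t]\}$. For $r\in[\dim(\mathcal{C})]$, the $r$-th generalized weight is $d_r(\mathcal{C})=\min\{\mathrm{wt}(\mathcal{D})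 : \mathcal{D}\text{ is a subcode of }\mathcal{C},\ \dim(\mathcal{D})\geq r\}$. Chain condition: a $k$-dimensional code $\mathcal{C}\neq 0$ satisfies the chain condition if there is a chain of subcodes $0\subsetneq\mathcal{D}_1\subsetneq\cdots\subsetneq\mathcal{D}_k=\mathcal{C}$ with $\mathrm{wt}(\mathcal{D}_r)=d_r(\mathcal{C})$ for all $r\in[k]$. Greedy weights: for a $k$-dimensional code $\mathcal{C}\neq 0$, a greedy $1$-subcode is a $1$-dimensional subcode $\mathcal{D}_1$ with $\mathrm{wt}(\mathcal{D}_1)=d_1(\mathcal{C})$; for $2\leq r\leq k$ a greedy $r$-subcode is an $r$-dimensional subcode of $\mathcal{C}$ of minimum weight among those that contain a greedy $(r-1)$-subcode. The $r$-th greedy weight is $g_r(\mathcal{C})=\mathrm{wt}(\mathcal{D}_r)$ for any greedy $r$-subcode $\mathcal{D}_r$. *)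

theory Defs
  imports "Jordan_Normal_Form.DL_Rank"
begin

text \<open>The field with \<open>q\<close> elements is an arbitrary type \<open>'a :: {field, finite}\<close>, viewed
  as the \<^const>\<open>class_ring\<close>; so \<open>q\<close> is its cardinality, which ranges over all prime powers.
  Sizes are given by functions \<open>m\<close>, \<open>n\<close>, of which only the values on \<open>{1..t}\<close> matter.\<close>

text \<open>The carrier consists of extensional functions, so that tuples are determined by their
  entries at the indices in \<open>I\<close>. The fields \<open>mult\<close> and \<open>one\<close> of a module record are
  irrelevant.\<close>

definition module_product ::
    "'i set \<Rightarrow> ('i \<Rightarrow> ('a, 'b) module) \<Rightarrow> ('a, 'i \<Rightarrow> 'b) module" where
  "module_product I N =
    \<lparr>carrier = (\<Pi>\<^sub>E i\<in>I. carrier (N i)),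
     mult = undefined,
     one = undefined,
     zero = (\<lambda>i\<in>I. \<zero>\<^bsub>N i\<^esub>),
     add = (\<lambda>x y. \<lambda>i\<in>I. x i \<oplus>\<^bsub>N i\<^esub> y i),
     smult = (\<lambda>a x. \<lambda>i\<in>I. a \<odot>\<^bsub>N i\<^esub> x i)\<rparr>"

definition sum_rank_space ::
    "nat \<Rightarrow> (nat \<Rightarrow> nat) \<Rightarrow> (nat \<Rightarrow> nat) \<Rightarrow> ('a :: field, nat \<Rightarrow> 'a mat) module" where
  "sum_rank_space t m n = module_product {1..t} (\<lambda>i. module_mat TYPE('a) (m i) (n i))"

lemma vectorspace_module_product:
  assumes "field K" and N: "\<And>i. i \<in> I \<Longrightarrow> vectorspace K (N i)"
  shows "vectorspace K (module_product I N)"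
proof -
  have md: "module K (N i)" if "i \<in> I" for i
    using N[OF that] by (simp add: vectorspace_def)
  have ab: "abelian_group (N i)" if "i \<in> I" for i
    using module.axioms(2)[OF md[OF that]] .
  have cr: "cring K"
    using assms(1) by (intro domain.axioms(1) field.axioms(1))
  note closed = abelian_monoid.a_closed[OF abelian_group.axioms(1)[OF ab]]
    abelian_monoid.zero_closed[OF abelian_group.axioms(1)[OF ab]]
    module.smult_closed[OF md]
  note [simp] = module_product_def closed
    abelian_monoid.l_zero[OF abelian_group.axioms(1)[OF ab]]
  have "abelian_group (module_product I N)"
  proof (rule abelian_groupI, goal_cases)
    case (3 x y z)
    then show ?case
      by (auto intro!: restrict_ext abelian_monoid.a_assoc[OF abelian_group.axioms(1)[OF ab]]
          simp: PiE_iff)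
  next
    case (4 x y)
    then show ?case
      by (auto intro!: restrict_ext abelian_monoid.a_comm[OF abelian_group.axioms(1)[OF ab]]
          simp: PiE_iff)
  next
    case (5 x)
    then show ?case
      by (auto intro!: extensionalityI[where A = I] simp: PiE_iff)
  next
    case (6 x)
    have "(\<lambda>i\<in>I. \<ominus>\<^bsub>N i\<^esub> x i) \<in> carrier (module_product I N)"
      using 6 by (auto intro!: abelian_group.a_inv_closed[OF ab] simp: PiE_iff)
    moreover have "(\<lambda>i\<in>I. \<ominus>\<^bsub>N i\<^esub> x i) \<oplus>\<^bsub>module_product I N\<^esub> x = \<zero>\<^bsub>module_product I N\<^esub>"
      using 6 by (auto intro!: restrict_ext abelian_group.l_neg[OF ab] simp: PiE_iff)
    ultimately show ?case by blast
  qed (auto simp: PiE_iff intro!: closed)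
  then have "module K (module_product I N)"
  proof (intro moduleI[OF cr], goal_cases)
    case (3 a b x)
    then show ?case
      by (auto intro!: restrict_ext module.smult_l_distr[OF md] simp: PiE_iff)
  next
    case (4 a x y)
    then show ?case
      by (auto intro!: restrict_ext module.smult_r_distr[OF md] simp: PiE_iff)
  next
    case (5 a b x)
    then show ?case
      by (auto intro!: restrict_ext module.smult_assoc1[OF md] simp: PiE_iff)
  next
    case (6 x)
    then show ?case
      by (auto intro!: extensionalityI[where A = I] module.smult_one[OF md] simp: PiE_iff)
  qed (auto simp: PiE_iff intro!: closed)
  with assms(1) show ?thesis by (simp add: vectorspace_def)
qed

lemma vectorspace_sum_rank_space:
  "vectorspace class_ring (sum_rank_space t m n :: ('a :: field, nat \<Rightarrow> 'a mat) module)"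
  unfolding sum_rank_space_def
  by (intro vectorspace_module_product matrix_vs class_field)

definition code ::
    "nat \<Rightarrow> (nat \<Rightarrow> nat) \<Rightarrow> (nat \<Rightarrow> nat) \<Rightarrow> (nat \<Rightarrow> 'a :: field mat) set \<Rightarrow> bool" where
  "code t m n C \<longleftrightarrow> subspace class_ring C (sum_rank_space t m n)"

definition code_dim ::
    "nat \<Rightarrow> (nat \<Rightarrow> nat) \<Rightarrow> (nat \<Rightarrow> nat) \<Rightarrow> (nat \<Rightarrow> 'a :: field mat) set \<Rightarrow> nat" where
  "code_dim t m n C = vectorspace.dim class_ring ((sum_rank_space t m n)\<lparr>carrier := C\<rparr>)"

definition subcode ::
    "nat \<Rightarrow> (nat \<Rightarrow> nat) \<Rightarrow> (nat \<Rightarrow> nat) \<Rightarrow> (nat \<Rightarrow> 'a :: field mat) set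
      \<Rightarrow> (nat \<Rightarrow> 'a mat) set \<Rightarrow> bool" where
  "subcode t m n C D \<longleftrightarrow> code t m n D \<and> D \<subseteq> C"

definition srk :: "nat \<Rightarrow> (nat \<Rightarrow> nat) \<Rightarrow> (nat \<Rightarrow> 'a :: field mat) \<Rightarrow> nat" where
  "srk t m X = (\<Sum>i\<in>{1..t}. vec_space.rank (m i) (X i))"

definition maxsrk :: "nat \<Rightarrow> (nat \<Rightarrow> nat) \<Rightarrow> (nat \<Rightarrow> 'a :: field mat) set \<Rightarrow> nat" where
  "maxsrk t m C = Max (srk t m ` C)"

definition optimal_anticode :: "nat \<Rightarrow> nat \<Rightarrow> 'a :: field mat set \<Rightarrow> bool" where
  "optimal_anticode nr nc A \<longleftrightarrow>
     subspace class_ring A (module_mat TYPE('a) nr nc) \<and>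
     vectorspace.dim class_ring ((module_mat TYPE('a) nr nc)\<lparr>carrier := A\<rparr>) =
       nr * Max (vec_space.rank nr ` A)"

definition wt ::
    "nat \<Rightarrow> (nat \<Rightarrow> nat) \<Rightarrow> (nat \<Rightarrow> nat) \<Rightarrow> (nat \<Rightarrow> 'a :: field mat) set \<Rightarrow> nat" where
  "wt t m n C = Min {maxsrk t m (\<Pi>\<^sub>E i\<in>{1..t}. A i) | A.
     (\<forall>i\<in>{1..t}. optimal_anticode (m i) (n i) (A i)) \<and> C \<subseteq> (\<Pi>\<^sub>E i\<in>{1..t}. A i)}"

definition generalized_weight ::
    "nat \<Rightarrow> (nat \<Rightarrow> nat) \<Rightarrow> (nat \<Rightarrow> nat) \<Rightarrow> (nat \<Rightarrow> 'a :: field mat) set \<Rightarrow> nat \<Rightarrow> nat" where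
  "generalized_weight t m n C r =
     Min {wt t m n D | D. subcode t m n C D \<and> r \<le> code_dim t m n D}"

definition chain_condition ::
    "nat \<Rightarrow> (nat \<Rightarrow> nat) \<Rightarrow> (nat \<Rightarrow> nat) \<Rightarrow> (nat \<Rightarrow> 'a :: field mat) set \<Rightarrow> bool" where
  "chain_condition t m n C \<longleftrightarrow>
     (let k = code_dim t m n C in
      \<exists>D :: nat \<Rightarrow> (nat \<Rightarrow> 'a mat) set.
        (\<forall>r\<in>{1..k}. subcode t m n C (D r)) \<and>
        {\<zero>\<^bsub>sum_rank_space t m n\<^esub>} \<subset> D 1 \<and>
        (\<forall>r\<in>{1..<k}. D r \<subset> D (Suc r)) \<and>
        D k = C \<and>
        (\<forall>r\<in>{1..k}. wt t m n (D r) = generalized_weight t m n C r))"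

text \<open>\<open>greedy_subcode t m n C r D\<close> says that \<open>D\<close> is a greedy \<open>r\<close>-subcode of \<open>C\<close>; there is
  none for \<open>r = 0\<close>.\<close>

fun greedy_subcode ::
    "nat \<Rightarrow> (nat \<Rightarrow> nat) \<Rightarrow> (nat \<Rightarrow> nat) \<Rightarrow> (nat \<Rightarrow> 'a :: field mat) set \<Rightarrow> nat
      \<Rightarrow> (nat \<Rightarrow> 'a mat) set \<Rightarrow> bool" where
  "greedy_subcode t m n C 0 D \<longleftrightarrow> False"
| "greedy_subcode t m n C (Suc 0) D \<longleftrightarrow>
     subcode t m n C D \<and> code_dim t m n D = 1 \<and>
     wt t m n D = generalized_weight t m n C 1"
| "greedy_subcode t m n C (Suc (Suc r)) D \<longleftrightarrow>
     is_arg_min (wt t m n)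
       (\<lambda>E. subcode t m n C E \<and> code_dim t m n E = Suc (Suc r) \<and>
            (\<exists>G. greedy_subcode t m n C (Suc r) G \<and> G \<subseteq> E)) D"

text \<open>All greedy \<open>r\<close>-subcodes have the same weight, so the choice is immaterial.\<close>

definition greedy_weight ::
    "nat \<Rightarrow> (nat \<Rightarrow> nat) \<Rightarrow> (nat \<Rightarrow> nat) \<Rightarrow> (nat \<Rightarrow> 'a :: field mat) set \<Rightarrow> nat \<Rightarrow> nat" where
  "greedy_weight t m n C r = wt t m n (SOME D. greedy_subcode t m n C r D)"

lemma greedy_subcode_wt_unique:
  assumes "greedy_subcode t m n C r D" and "greedy_subcode t m n C r D'"
  shows "wt t m n D = wt t m n D'"
  using assms by (cases "(t, m, n, C, r, D)" rule: greedy_subcode.cases)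
    (auto simp: is_arg_min_linorder intro: antisym)

end

theory Submission
  imports Defs
begin

text \<open>Along a chain of subcodes that realises the generalized weights, the dimension grows by
  exactly one in each step, so each member is a greedy subcode. Conversely, a greedy
  \<open>k\<close>-subcode unwinds to a chain of greedy subcodes. That greedy subcodes exist
  uses that the weight is monotone, so that the first generalized weight is attained in dimension
  one; this rests on the full matrix spaces being optimal anticodes, which is where \<open>n i \<le> m i\<close>
  enters.\<close>

section \<open>Vector spaces over a finite field\<close>

lemma (in vectorspace) subspace_subset_carrier:
  "subspace K W V \<Longrightarrow> W \<subseteq> carrier V"
  by (simp add: subspace_def submodule_def)

text \<open>Coordinates with respect to a finite basis \<open>B\<close> identify vectors with
  functions from \<open>B\<close> to the field. Over a finite field this lets dimensions be compared
  by counting.\<close>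

lemma (in vectorspace) card_eq_card_pow_dim:
  assumes "fin_dim"
  shows "card (carrier V) = card (carrier K) ^ dim"
proof -
  obtain B where B: "finite B" "basis B"
    using finite_basis_exists[OF assms] by blast
  have BV: "B \<subseteq> carrier V"
    using B(2) by (simp add: basis_def)
  have ex1: "\<forall>v\<in>carrier V. \<exists>!a. a \<in> B \<rightarrow>\<^sub>E carrier K \<and> lincomb a B = v"
    using basis_criterion[OF B(1) BV] B(2) by blast
  have closed: "lincomb a B \<in> carrier V" if "a \<in> B \<rightarrow>\<^sub>E carrier K" for a
    using that BV by (intro lincomb_closed) auto
  have "bij_betw (\<lambda>a. lincomb a B) (B \<rightarrow>\<^sub>E carrier K) (carrier V)"
  proof (rule bij_betw_imageI)
    show "inj_on (\<lambda>a. lincomb a B) (B \<rightarrow>\<^sub>E carrier K)"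
      using ex1 closed by (intro inj_onI) blast
    show "(\<lambda>a. lincomb a B) ` (B \<rightarrow>\<^sub>E carrier K) = carrier V"
      using ex1 closed by blast
  qed
  then have "card (B \<rightarrow>\<^sub>E carrier K) = card (carrier V)"
    by (rule bij_betw_same_card)
  then show ?thesis
    using B dim_basis[OF B] by (simp add: card_funcsetE)
qed

lemma (in vectorspace) fin_dim_if_finite:
  assumes "finite (carrier V)"
  shows "fin_dim"
proof -
  have "span (carrier V) = carrier V"
    using in_own_span[of "carrier V"] subspace_subset_carrier[OF span_is_subspace[of "carrier V"]]
    by blast
  then show ?thesis
    using assms unfolding fin_dim_def by blast
qed

lemma (in vectorspace) card_subspace:
  assumes "finite (carrier V)" and "subspace K W V"
  shows "card W = card (carrier K) ^ vectorspace.dim K (vs W)"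
proof -
  have "finite W"
    using assms subspace_subset_carrier finite_subset by blast
  then show ?thesis
    using vectorspace.card_eq_card_pow_dim[OF subspace_is_vs[OF assms(2)]
        vectorspace.fin_dim_if_finite[OF subspace_is_vs[OF assms(2)]]]
    by simp
qed

text \<open>A basis of \<open>U\<close> together with one vector of \<open>W\<close> outside
  \<open>U\<close> spans a suitable \<open>X\<close>. This supplies the one-step enlargements from
  which greedy subcodes are built.\<close>

lemma (in vectorspace) extend_subspace:
  assumes fin: "finite (carrier V)"
    and U: "subspace K U V" and W: "subspace K W V" and UW: "U \<subset> W"
  obtains X where "subspace K X V" "U \<subseteq> X" "X \<subseteq> W"
    "vectorspace.dim K (vs X) = Suc (vectorspace.dim K (vs U))"
proof -
  have vsU: "vectorspace K (vs U)"
    using subspace_is_vs[OF U] .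
  have subU: "submodule K U V" and subW: "submodule K W V"
    using U W by simp_all
  have WV: "W \<subseteq> carrier V"
    using subspace_subset_carrier[OF W] .
  have "finite U"
    using fin UW WV by (meson finite_subset psubset_imp_subset)
  then obtain B where B: "finite B" "vectorspace.basis K (vs U) B"
    using vectorspace.finite_basis_exists[OF vsU vectorspace.fin_dim_if_finite[OF vsU]] by auto
  have BU: "B \<subseteq> U"
    using B(2) by (simp add: vectorspace.basis_def[OF vsU])
  \<comment> \<open>Being a basis of \<open>U\<close> is a property inside \<open>vs U\<close>;
    independence and span are transferred to the ambient space, where the new vector lives.\<close>
  have liB: "lin_indpt B"
    using B(2) module.span_li_not_depend(2)[OF BU subU] by (simp add: vectorspace.basis_def[OF vsU])
  have spB: "span B = U"
    using B(2) module.span_li_not_depend(1)[OF BU subU] by (simp add: vectorspace.basis_def[OF vsU])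
  have dimU: "vectorspace.dim K (vs U) = card B"
    using vectorspace.dim_basis[OF vsU B] .
  obtain v where v: "v \<in> W" "v \<notin> U"
    using UW by blast
  have SW: "B \<union> {v} \<subseteq> W"
    using BU UW v by blast
  have SV: "B \<union> {v} \<subseteq> carrier V"
    using SW WV by blast
  have "lin_indpt (B \<union> {v})"
    using lin_dep_iff_in_span[of B v] liB SV BU spB v by auto
  \<comment> \<open>\<open>dim_span\<close> counts a maximal independent subset of the spanning set;
    here that is the whole set.\<close>
  then have "maximal (B \<union> {v}) (\<lambda>T. T \<subseteq> B \<union> {v} \<and> lin_indpt T)"
    by (auto simp: maximal_def)
  then have "vectorspace.dim K (vs (span (B \<union> {v}))) = Suc (card B)"
    using dim_span[OF SV] B(1) BU v by (auto simp: card_insert_if)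
  moreover have "U \<subseteq> span (B \<union> {v})"
    using span_is_monotone[of B "B \<union> {v}"] spB by auto
  moreover have "span (B \<union> {v}) \<subseteq> W"
    using span_is_subset[OF SW subW] .
  ultimately show ?thesis
    using that span_is_subspace[OF SV] dimU by metis
qed

text \<open>A base above 1 makes powers strictly increasing in the exponent, so comparisons of
  cardinalities become comparisons of dimensions.\<close>

lemma card_field_gt_one: "card (UNIV :: 'a :: {field, finite} set) > 1"
  using card_mono[of UNIV "{0, 1 :: 'a}"] by simp

section \<open>The full matrix space is an optimal anticode\<close>

lemma card_carrier_mat:
  "card (carrier_mat nr nc :: 'a :: finite mat set) = card (UNIV :: 'a set) ^ (nr * nc)"
proof -
  let ?I = "{..<nr} \<times> {..<nc}"
  have "bij_betw (\<lambda>f. mat nr nc f) (?I \<rightarrow>\<^sub>E (UNIV :: 'a set)) (carrier_mat nr nc)"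
  \<comment> \<open>The inverse reads off the entries, restricted to the index grid so that the
    result is extensional.\<close>
  proof (rule bij_betwI[where g = "\<lambda>A. restrict (\<lambda>ij. A $$ ij) ?I"])
    fix f :: "nat \<times> nat \<Rightarrow> 'a"
    assume "f \<in> ?I \<rightarrow>\<^sub>E UNIV"
    then show "restrict (\<lambda>ij. mat nr nc f $$ ij) ?I = f"
      by (intro extensionalityI[where A = ?I]) (auto simp: PiE_iff)
  qed (auto intro!: eq_matI)
  from bij_betw_same_card[OF this] show ?thesis
    by (simp add: card_funcsetE)
qed

text \<open>An infinite set has \<open>card\<close> 0, whereas the number of matrices is a positive
  power.\<close>

lemma finite_carrier_mat: "finite (carrier_mat nr nc :: 'a :: finite mat set)"
  by (rule card_ge_0_finite) (simp add: card_carrier_mat card_gt_0_iff)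

text \<open>An identity block padded with zero rows works: by \<open>nc \<le> nr\<close> its columns
  are the first \<open>nc\<close> unit vectors, which are distinct and independent.\<close>

lemma exists_full_col_rank_mat:
  assumes "nc \<le> nr"
  shows "\<exists>A \<in> carrier_mat nr nc. vec_space.rank nr (A :: 'a :: field mat) = nc"
proof -
  interpret vec_space "TYPE('a)" nr .
  let ?A = "mat nr nc (\<lambda>(i, j). if i = j then 1 else 0) :: 'a mat"
  have col: "col ?A j = unit_vec nr j" if "j < nc" for j
    using that assms by (intro eq_vecI) (auto simp: unit_vec_def)
  have cols: "cols ?A = map (unit_vec nr) [0..<nc]"
    using col by (auto simp: cols_def)
  have "distinct (cols ?A)"
    using assms by (auto simp: cols distinct_map inj_on_def unit_vec_eq)
  moreover have "set (cols ?A) \<subseteq> set (unit_vecs nr)"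
    using assms by (auto simp: cols unit_vecs_def)
  then have "lin_indpt (set (cols ?A))"
    using unit_vecs_basis basis_def subset_li_is_li by metis
  ultimately have "rank ?A = nc"
    by (intro lin_indpt_full_rank) auto
  then show ?thesis
    by (intro bexI[of _ ?A]) auto
qed

text \<open>The dimension is \<open>nr * nc\<close> and, as \<open>nc \<le> nr\<close>, the maximal
  rank is \<open>nc\<close>. Thus the minimum in \<open>wt\<close> always has a candidate.\<close>

lemma optimal_anticode_carrier_mat:
  assumes "nc \<le> nr"
  shows "optimal_anticode nr nc (carrier_mat nr nc :: 'a :: {field, finite} mat set)"
proof -
  let ?V = "module_mat TYPE('a) nr nc"
  let ?M = "carrier_mat nr nc :: 'a mat set"
  interpret V: vectorspace class_ring ?V
    by (rule matrix_vs)
  have cV: "carrier ?V = ?M"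
    by (simp add: module_mat_simps)
  have full: "?V\<lparr>carrier := ?M\<rparr> = ?V"
    by (simp add: module_mat_def)
  \<comment> \<open>The full carrier is its own span.\<close>
  have sub: "subspace class_ring ?M ?V"
    using V.span_is_subspace[of ?M] V.in_own_span[of ?M] V.span_closed[of ?M] cV
    by (metis subsetI subset_antisym subset_refl)
  \<comment> \<open>Both sides count the carrier: once by entries, once by coordinates.\<close>
  have "card (UNIV :: 'a set) ^ (nr * nc) = card (UNIV :: 'a set) ^ V.dim"
    using V.card_eq_card_pow_dim V.fin_dim_if_finite
    by (simp add: cV finite_carrier_mat card_carrier_mat class_ring_simps)
  then have dim: "V.dim = nr * nc"
    using card_field_gt_one[where 'a = 'a] by simp
  obtain A :: "'a mat" where "A \<in> ?M" "vec_space.rank nr A = nc"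
    using exists_full_col_rank_mat[OF assms] by blast
  then have "Max (vec_space.rank nr ` ?M) = nc"
    by (intro Max_eqI) (auto simp: finite_carrier_mat vec_space.rank_le_nc)
  then show ?thesis
    using sub dim by (simp add: optimal_anticode_def full)
qed

section \<open>Codes\<close>

lemma carrier_sum_rank_space:
  "carrier (sum_rank_space t m n) = (\<Pi>\<^sub>E i\<in>{1..t}. carrier_mat (m i) (n i))"
  by (simp add: sum_rank_space_def module_product_def module_mat_simps)

lemma finite_carrier_sum_rank_space:
  "finite (carrier (sum_rank_space t m n :: ('a :: {field, finite}, _) module))"
  unfolding carrier_sum_rank_space by (intro finite_PiE finite_carrier_mat) simp

lemma code_subset_carrier:
  "code t m n D \<Longrightarrow> D \<subseteq> carrier (sum_rank_space t m n)"
  unfolding code_def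
  by (rule vectorspace.subspace_subset_carrier[OF vectorspace_sum_rank_space])

lemma finite_codes: "finite {D :: (nat \<Rightarrow> 'a :: {field, finite} mat) set. code t m n D}"
  by (rule finite_subset[of _ "Pow (carrier (sum_rank_space t m n))"])
    (auto simp: finite_carrier_sum_rank_space dest: code_subset_carrier)

lemma zero_in_code: "code t m n D \<Longrightarrow> \<zero>\<^bsub>sum_rank_space t m n\<^esub> \<in> D"
  by (simp add: code_def subspace_def submodule_def)

lemma code_zero: "code t m n {\<zero>\<^bsub>sum_rank_space t m n\<^esub>}"
proof -
  interpret vectorspace class_ring "sum_rank_space t m n"
    by (rule vectorspace_sum_rank_space)
  show ?thesis
    unfolding code_def using span_is_subspace[of "{}"] by (simp add: span_empty)
qed

lemma card_code:
  fixes D :: "(nat \<Rightarrow> 'a :: {field, finite} mat) set"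
  shows "code t m n D \<Longrightarrow> card D = card (UNIV :: 'a set) ^ code_dim t m n D"
  using vectorspace.card_subspace[OF vectorspace_sum_rank_space finite_carrier_sum_rank_space]
  by (simp add: code_def code_dim_def class_ring_simps)

lemma finite_code:
  fixes D :: "(nat \<Rightarrow> 'a :: {field, finite} mat) set"
  shows "code t m n D \<Longrightarrow> finite D"
  using code_subset_carrier finite_carrier_sum_rank_space finite_subset by metis

lemma code_dim_mono:
  fixes D E :: "(nat \<Rightarrow> 'a :: {field, finite} mat) set"
  assumes "code t m n D" "code t m n E" "D \<subseteq> E"
  shows "code_dim t m n D \<le> code_dim t m n E"
  using card_mono[OF finite_code[OF assms(2)] assms(3)] card_field_gt_one[where 'a = 'a]
  by (simp add: card_code[OF assms(1)] card_code[OF assms(2)])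

lemma code_dim_strict_mono:
  fixes D E :: "(nat \<Rightarrow> 'a :: {field, finite} mat) set"
  assumes "code t m n D" "code t m n E" "D \<subset> E"
  shows "code_dim t m n D < code_dim t m n E"
  using psubset_card_mono[OF finite_code[OF assms(2)] assms(3)] card_field_gt_one[where 'a = 'a]
  by (simp add: card_code[OF assms(1)] card_code[OF assms(2)])

lemma code_dim_zero:
  "code_dim t m n {\<zero>\<^bsub>sum_rank_space t m n :: ('a :: {field, finite}, _) module\<^esub>} = 0"
proof -
  have "card (UNIV :: 'a set) ^ code_dim t m n {\<zero>\<^bsub>sum_rank_space t m n :: ('a, _) module\<^esub>} = 1"
    using card_code[OF code_zero, where 'a = 'a, of t m n] by simp
  then show ?thesis
    using card_field_gt_one[where 'a = 'a] by (simp add: nat_power_eq_Suc_0_iff)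
qed

lemma extend_subcode:
  fixes D E :: "(nat \<Rightarrow> 'a :: {field, finite} mat) set"
  assumes "code t m n D" "code t m n E" "D \<subset> E"
  obtains X where "subcode t m n E X" "D \<subseteq> X" "code_dim t m n X = Suc (code_dim t m n D)"
  by (rule vectorspace.extend_subspace[OF vectorspace_sum_rank_space finite_carrier_sum_rank_space
        assms[unfolded code_def]])
    (simp add: that code_def code_dim_def subcode_def)

section \<open>Weights\<close>

text \<open>A product of optimal anticodes containing \<open>E\<close> also contains
  \<open>D\<close>, so the minimum for \<open>D\<close> is over a larger set. Comparing the two
  \<open>Min\<close> terms requires the smaller set to be nonempty and the larger one
  finite.\<close>

lemma wt_mono:
  fixes D E :: "(nat \<Rightarrow> 'a :: {field, finite} mat) set"
  assumes nm: "\<And>i. i \<in> {1..t} \<Longrightarrow> n i \<le> m i" and "D \<subseteq> E" "code t m n E"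
  shows "wt t m n D \<le> wt t m n E"
  unfolding wt_def
proof (rule Min_antimono)
  let ?P = "\<lambda>A :: nat \<Rightarrow> 'a mat set. \<Pi>\<^sub>E i\<in>{1..t}. A i"
  let ?S = "\<lambda>X. {maxsrk t m (?P A) | A.
    (\<forall>i\<in>{1..t}. optimal_anticode (m i) (n i) (A i)) \<and> X \<subseteq> ?P A}"
  show "?S E \<subseteq> ?S D"
    using \<open>D \<subseteq> E\<close> by blast
  have "E \<subseteq> ?P (\<lambda>i. carrier_mat (m i) (n i))"
    using code_subset_carrier[OF assms(3)] by (simp add: carrier_sum_rank_space)
  moreover have "\<forall>i\<in>{1..t}. optimal_anticode (m i) (n i) (carrier_mat (m i) (n i) :: 'a mat set)"
    by (intro ballI optimal_anticode_carrier_mat nm)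
  ultimately have "maxsrk t m (?P (\<lambda>i. carrier_mat (m i) (n i))) \<in> ?S E"
    by (intro CollectI exI conjI) (rule refl)
  then show "?S E \<noteq> {}"
    by (metis empty_iff)
  have "A i \<subseteq> carrier_mat (m i) (n i)" if "optimal_anticode (m i) (n i) (A i)"
    for i and A :: "nat \<Rightarrow> 'a mat set"
    using that vectorspace.subspace_subset_carrier[OF matrix_vs, of "A i" "m i" "n i"]
    by (simp add: optimal_anticode_def module_mat_simps)
  then have in_carrier: "?P A \<subseteq> carrier (sum_rank_space t m n)"
    if "\<forall>i\<in>{1..t}. optimal_anticode (m i) (n i) (A i)" for A :: "nat \<Rightarrow> 'a mat set"
    using that unfolding carrier_sum_rank_space by (intro PiE_mono) blast
  \<comment> \<open>The families \<open>A\<close> are arbitrary outside \<open>{1..t}\<close>, so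
    finiteness is argued through their products, which are subsets of a finite carrier.\<close>
  have "?S D \<subseteq> maxsrk t m ` Pow (carrier (sum_rank_space t m n :: ('a, _) module))"
    using in_carrier by blast
  then show "finite (?S D)"
    by (rule finite_subset) (simp add: finite_carrier_sum_rank_space)
qed

lemma finite_subcode_weights:
  fixes C :: "(nat \<Rightarrow> 'a :: {field, finite} mat) set"
  shows "finite {wt t m n D | D. subcode t m n C D \<and> r \<le> code_dim t m n D}"
  by (rule finite_subset[of _ "wt t m n ` {D. code t m n D}"])
    (auto simp: subcode_def finite_codes)

lemma generalized_weight_le:
  fixes C :: "(nat \<Rightarrow> 'a :: {field, finite} mat) set"
  assumes "subcode t m n C D" "r \<le> code_dim t m n D"
  shows "generalized_weight t m n C r \<le> wt t m n D"
  unfolding generalized_weight_def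
  using assms by (intro Min_le finite_subcode_weights) blast

lemma generalized_weight_attained:
  fixes C :: "(nat \<Rightarrow> 'a :: {field, finite} mat) set"
  assumes "code t m n C" "r \<le> code_dim t m n C"
  obtains D where "subcode t m n C D" "r \<le> code_dim t m n D"
    "wt t m n D = generalized_weight t m n C r"
proof -
  let ?S = "{wt t m n D | D. subcode t m n C D \<and> r \<le> code_dim t m n D}"
  have "?S \<noteq> {}"
    using assms by (auto simp: subcode_def)
  from Min_in[OF finite_subcode_weights this] show ?thesis
    using that unfolding generalized_weight_def by force
qed

section \<open>Greedy subcodes and chains of them\<close>

lemma greedy_subcodeD:
  assumes "greedy_subcode t m n C r D"
  shows "subcode t m n C D" "code_dim t m n D = r"
  using assms by (cases "(t, m, n, C, r, D)" rule: greedy_subcode.cases;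
      auto simp: is_arg_min_def)+

lemma greedy_weight_eq:
  "greedy_subcode t m n C r D \<Longrightarrow> greedy_weight t m n C r = wt t m n D"
  unfolding greedy_weight_def by (rule greedy_subcode_wt_unique) (rule someI)

text \<open>Base: a subcode attaining the first generalized weight may have dimension above one, but
  a one-dimensional subcode of it weighs no more. Step: a greedy subcode extends by one dimension,
  so the set to be minimised over is nonempty.\<close>

lemma greedy_subcode_exists:
  fixes C :: "(nat \<Rightarrow> 'a :: {field, finite} mat) set"
  assumes nm: "\<And>i. i \<in> {1..t} \<Longrightarrow> n i \<le> m i" and C: "code t m n C"
  shows "r < code_dim t m n C \<Longrightarrow> \<exists>D. greedy_subcode t m n C (Suc r) D"
proof (induction r)
  case 0
  then obtain E where E: "subcode t m n C E" "1 \<le> code_dim t m n E"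
    "wt t m n E = generalized_weight t m n C 1"
    using generalized_weight_attained[OF C, of 1] by auto
  let ?Z = "{\<zero>\<^bsub>sum_rank_space t m n :: ('a, _) module\<^esub>}"
  have cE: "code t m n E" "E \<subseteq> C"
    using E(1) by (auto simp: subcode_def)
  have "?Z \<noteq> E"
    using E(2) code_dim_zero[where 'a = 'a] by force
  then have "?Z \<subset> E"
    using zero_in_code[OF cE(1)] by blast
  then obtain D where D: "subcode t m n E D" "code_dim t m n D = 1"
    using extend_subcode[OF code_zero cE(1)] by (metis One_nat_def code_dim_zero)
  then have DC: "subcode t m n C D"
    using cE by (auto simp: subcode_def)
  have "wt t m n D \<le> wt t m n E"
    using D(1) by (intro wt_mono nm cE) (auto simp: subcode_def)
  \<comment> \<open>Monotonicity gives one inequality, minimality of the generalized weight the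
    other.\<close>
  then have "wt t m n D = generalized_weight t m n C 1"
    using generalized_weight_le[OF DC, of 1] D(2) E(3) by simp
  then show ?case
    using DC D(2) by auto
next
  case (Suc r)
  then obtain G where G: "greedy_subcode t m n C (Suc r) G"
    by auto
  note G' = greedy_subcodeD[OF G]
  have "G \<subset> C"
    using G' Suc.prems by (auto simp: subcode_def)
  then obtain X where "subcode t m n C X" "G \<subseteq> X" "code_dim t m n X = Suc (Suc r)"
    using extend_subcode[OF _ C] G' by (metis subcode_def)
  \<comment> \<open>\<open>X\<close> is a candidate, and a weight in the natural numbers attains its
    minimum.\<close>
  with G show ?case
    unfolding greedy_subcode.simps
    by - (rule exI, rule is_arg_min_arg_min_nat[where x = X], blast)
qed

text \<open>Unwinds the recursion from the top: each greedy subcode beyond the first contains a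
  greedy one of dimension one less.\<close>

lemma greedy_chain_exists:
  assumes "greedy_subcode t m n C (Suc j) D"
  shows "\<exists>F. F (Suc j) = D \<and> (\<forall>r\<in>{1..Suc j}. greedy_subcode t m n C r (F r)) \<and>
    (\<forall>r\<in>{1..j}. F r \<subseteq> F (Suc r))"
  using assms
proof (induction j arbitrary: D)
  case 0
  then show ?case
    by (intro exI[of _ "\<lambda>_. D"]) auto
next
  case (Suc j)
  then obtain G where G: "greedy_subcode t m n C (Suc j) G" "G \<subseteq> D"
    by (auto simp: is_arg_min_def)
  obtain F where F: "F (Suc j) = G" "\<forall>r\<in>{1..Suc j}. greedy_subcode t m n C r (F r)"
    "\<forall>r\<in>{1..j}. F r \<subseteq> F (Suc r)"
    using Suc.IH[OF G(1)] by blast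
  \<comment> \<open>Overwriting index \<open>Suc (Suc j)\<close> leaves the shorter chain intact;
    the new inclusion is \<open>G \<subseteq> D\<close>.\<close>
  show ?case
    using F G(2) Suc.prems
    by (intro exI[of _ "F(Suc (Suc j) := D)"])
      (auto simp del: greedy_subcode.simps simp: le_Suc_eq)
qed

theorem proposition2p11:
  fixes t k :: nat and m n :: "nat \<Rightarrow> nat"
    and C :: "(nat \<Rightarrow> 'a :: {field, finite} mat) set"
  assumes "t \<ge> 1"
    and "\<And>i. i \<in> {1..t} \<Longrightarrow> n i \<ge> 1"
    and "\<And>i. i \<in> {1..t} \<Longrightarrow> m i \<ge> 1"
    and "\<And>i j. i \<in> {1..t} \<Longrightarrow> j \<in> {1..t} \<Longrightarrow> i \<le> j \<Longrightarrow> m i \<ge> m j"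
    and "\<And>i. i \<in> {1..t} \<Longrightarrow> m i \<ge> n i"
    and "code t m n C"
    and "code_dim t m n C = k"
    and "k \<ge> 1"
  shows "chain_condition t m n C \<longleftrightarrow>
    (\<forall>r\<in>{1..k}. generalized_weight t m n C r = greedy_weight t m n C r)"
proof
  assume "chain_condition t m n C"
  then obtain D where D: "\<And>r. r \<in> {1..k} \<Longrightarrow> subcode t m n C (D r)"
    "{\<zero>\<^bsub>sum_rank_space t m n\<^esub>} \<subset> D 1"
    "\<And>r. r \<in> {1..<k} \<Longrightarrow> D r \<subset> D (Suc r)"
    "D k = C"
    "\<And>r. r \<in> {1..k} \<Longrightarrow> wt t m n (D r) = generalized_weight t m n C r"
    unfolding chain_condition_def Let_def assms(7) by metis
  have code_D: "code t m n (D r)" if "r \<in> {1..k}" for r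
    using D(1)[OF that] by (simp add: subcode_def)
  have step: "code_dim t m n (D r) < code_dim t m n (D (Suc r))" if "r \<in> {1..<k}" for r
    using that by (intro code_dim_strict_mono code_D D(3)) auto
  \<comment> \<open>Counting up from the zero code, each strict inclusion adds at least one
    dimension.\<close>
  have lower: "Suc r \<le> code_dim t m n (D (Suc r))" if "r < k" for r
    using that
  proof (induction r)
    case 0
    show ?case
      using code_dim_strict_mono[OF code_zero code_D D(2)] assms(8) by simp
  next
    case (Suc r)
    then show ?case
      using step[of "Suc r"] by simp
  qed
  \<comment> \<open>Counting down from \<open>D k = C\<close>: the index \<open>k - j\<close> turns
    the descent into an induction on \<open>j\<close>, and \<open>j < k\<close> keeps it in
    \<open>{1..k}\<close>.\<close>
  have upper: "code_dim t m n (D (k - j)) \<le> k - j" if "j < k" for j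
    using that
  proof (induction j)
    case 0
    show ?case
      using D(4) assms(7) by simp
  next
    case (Suc j)
    have "code_dim t m n (D (k - Suc j)) < code_dim t m n (D (k - j))"
      using step[of "k - Suc j"] Suc.prems by (simp add: Suc_diff_Suc)
    then show ?case
      using Suc by linarith
  qed
  have dim_D: "code_dim t m n (D r) = r" if "r \<in> {1..k}" for r
    using that lower[of "r - 1"] upper[of "k - r"] by (intro antisym) auto
  have "greedy_subcode t m n C (Suc r) (D (Suc r))" if "r < k" for r
    using that
  proof (induction r)
    case 0
    then show ?case
      using D(1, 5) dim_D by simp
  next
    case (Suc r)
    then have *: "Suc (Suc r) \<in> {1..k}"
      by simp
    have "D (Suc r) \<subseteq> D (Suc (Suc r))"
      using D(3)[of "Suc r"] Suc.prems by auto
    \<comment> \<open>Minimality holds among all subcodes of this dimension, hence among those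
      containing a greedy subcode of dimension one less.\<close>
    moreover have "wt t m n (D (Suc (Suc r))) \<le> wt t m n E"
      if "subcode t m n C E" "code_dim t m n E = Suc (Suc r)" for E
      using generalized_weight_le[OF that(1), of "Suc (Suc r)"] that(2) D(5)[OF *] by simp
    ultimately show ?case
      using Suc D(1)[OF *] dim_D[OF *] by (auto simp: is_arg_min_linorder)
  qed
  then have "greedy_subcode t m n C r (D r)" if "r \<in> {1..k}" for r
    using that by (cases r) auto
  then show "\<forall>r\<in>{1..k}. generalized_weight t m n C r = greedy_weight t m n C r"
    using greedy_weight_eq D(5) by metis
next
  assume eq: "\<forall>r\<in>{1..k}. generalized_weight t m n C r = greedy_weight t m n C r"
  \<comment> \<open>Greedy subcodes start at index 1, so \<open>k\<close> is written as a
    successor.\<close>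
  obtain j where k: "k = Suc j"
    using assms(8) by (cases k) auto
  obtain G where "greedy_subcode t m n C (Suc j) G"
    using greedy_subcode_exists[OF assms(5, 6), of j] assms(7) k by auto
  then obtain F where F: "\<And>r. r \<in> {1..k} \<Longrightarrow> greedy_subcode t m n C r (F r)"
    "\<And>r. r \<in> {1..<k} \<Longrightarrow> F r \<subseteq> F (Suc r)"
    using greedy_chain_exists[of t m n C j G] unfolding k
    by (metis atLeastLessThanSuc_atLeastAtMost)
  have code_F: "code t m n (F r)" "F r \<subseteq> C" "code_dim t m n (F r) = r" if "r \<in> {1..k}" for r
    using greedy_subcodeD[OF F(1)[OF that]] by (auto simp: subcode_def)
  have "{\<zero>\<^bsub>sum_rank_space t m n\<^esub>} \<noteq> F 1"
    using code_F(3)[of 1] assms(8) code_dim_zero[where 'a = 'a, of t m n] by auto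
  then have "{\<zero>\<^bsub>sum_rank_space t m n\<^esub>} \<subset> F 1"
    using zero_in_code[OF code_F(1)[of 1]] assms(8) by auto
  moreover have "F r \<subset> F (Suc r)" if "r \<in> {1..<k}" for r
  proof -
    have "F r \<noteq> F (Suc r)"
      using code_F(3)[of r] code_F(3)[of "Suc r"] that by force
    then show ?thesis
      using F(2)[OF that] by blast
  qed
  \<comment> \<open>A proper subcode of \<open>C\<close> would have dimension below
    \<open>k\<close>.\<close>
  moreover have "F k = C"
    using code_dim_strict_mono[OF code_F(1) assms(6), of k] code_F(2, 3)[of k] assms(7, 8) by auto
  moreover have "wt t m n (F r) = generalized_weight t m n C r" if "r \<in> {1..k}" for r
    using greedy_weight_eq[OF F(1)[OF that]] eq that by simp
  ultimately show "chain_condition t m n C"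
    unfolding chain_condition_def Let_def assms(7)
    using code_F by (intro exI[of _ F]) (auto simp: subcode_def)
qed

end
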